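(* Let $G$ be a nontrivial cyclic group of order $n$, let $S$ be the set of all generators of $G$, and let $\Gamma(G)$ be the generator graph of $G$. Then $\dim(\Gamma(G)) = n-1$ if $n = |S|+1$, and $\dim(\Gamma(G)) = n-2$ if $n \ge |S|+2$.
   Context: For a group $G$, the generator graph $\Gamma(G)$ is the simple undirected graph whose vertex set is the set of elements of $G$, in which two distinct elements $x,y$ are adjacent if and only if at least one of them generates $G$ (i.e. $\langle x\rangle = G$ or $\langle y\rangle = G$). For a connected graph $\Gamma$ and an ordered set $W=\{w_1,\dots,w_k\}\subseteq V(\Gamma)$, the representation of a vertex $u$ is $r(u\mid W) = (d_\Gamma(u,w_1),\dots,d_\Gamma(u,w_k))$, with $d_\Gamma$ the graph distance; $W$ is a resolving set if $r(u\mid W)\ne r(v\mid W)$ for all distinct $u,v\in V(\Gamma)$. The metric dimension $\dim(\Gamma)$ is the minimum cardinality of a resolving set of $\Gamma$. *)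

theory Defs
  imports
    "HOL-Algebra.Elementary_Groups"
    "Graph_Theory.Graph_Theory"
begin

section \<open>Metric dimension\<close>

text \<open>
  Graphs are those of the session Graph_Theory: a simple undirected graph is a digraph with
  symmetric, loop-free arcs and no parallel arcs (locale \<open>graph\<close>). The graph
  distance is the infimum of the lengths of the walks between two vertices, i.e. the shortest-path
  distance \<open>\<mu>\<close> for unit arc weights. It takes values in the extended reals only because
  it is infinite between different components.
\<close>

definition graph_dist :: "('a, 'b) pre_digraph \<Rightarrow> 'a \<Rightarrow> 'a \<Rightarrow> ereal" where
  "graph_dist H u v = wf_digraph.\<mu> H (\<lambda>_. 1) u v"

definition representation :: "('a, 'b) pre_digraph \<Rightarrow> 'a list \<Rightarrow> 'a \<Rightarrow> ereal list" where
  "representation H W u = map (graph_dist H u) W"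

text \<open>An ordered set of vertices is a list without repetitions; its cardinality is its length.\<close>

definition resolving_set :: "('a, 'b) pre_digraph \<Rightarrow> 'a list \<Rightarrow> bool" where
  "resolving_set H W \<longleftrightarrow> distinct W \<and> set W \<subseteq> verts H \<and>
     (\<forall>u\<in>verts H. \<forall>v\<in>verts H. u \<noteq> v \<longrightarrow> representation H W u \<noteq> representation H W v)"

definition metric_dimension :: "('a, 'b) pre_digraph \<Rightarrow> nat" where
  "metric_dimension H = (LEAST k. \<exists>W. resolving_set H W \<and> length W = k)"

section \<open>The generator graph of a group\<close>

definition generators :: "('a, 'b) monoid_scheme \<Rightarrow> 'a set" where
  "generators G = {x \<in> carrier G. generate G {x} = carrier G}"

definition generator_graph :: "('a, 'b) monoid_scheme \<Rightarrow> 'a pair_pre_digraph" where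
  "generator_graph G =
     \<lparr> pverts = carrier G,
       parcs = {(x, y). x \<in> carrier G \<and> y \<in> carrier G \<and> x \<noteq> y \<and>
                        (x \<in> generators G \<or> y \<in> generators G)} \<rparr>"

lemma pair_wf_digraph_generator_graph: "pair_wf_digraph (generator_graph G)"
  by unfold_locales (auto simp: generator_graph_def)

lemma graph_generator_graph:
  assumes "finite (carrier G)"
  shows "graph (with_proj (generator_graph G))"
proof -
  have "finite (parcs (generator_graph G))"
    by (rule finite_subset[of _ "carrier G \<times> carrier G"])
       (use assms in \<open>auto simp: generator_graph_def\<close>)
  then have "pair_graph (generator_graph G)"
    using assms
    by unfold_locales (auto simp: generator_graph_def symmetric_def sym_def)
  then interpret pair_graph "generator_graph G" .
  show ?thesis
    by unfold_locales
qed

lemma (in group) cyclic_group_iff_generators: "cyclic_group G \<longleftrightarrow> generators G \<noteq> {}"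
proof -
  have "(carrier G = range (\<lambda>n::int. x [^] n)) = (generate G {x} = carrier G)"
    if "x \<in> carrier G" for x
    using generate_pow[OF that] by (auto simp: full_SetCompr_eq)
  then show ?thesis
    unfolding cyclic_group generators_def by auto
qed

lemma (in group) connected_generator_graph:
  assumes "cyclic_group G"
  shows "connected (with_proj (generator_graph G))"
proof -
  let ?H = "mk_symmetric (with_proj (generator_graph G))"
  obtain g where g: "g \<in> generators G"
    using assms cyclic_group_iff_generators by auto
  have gc: "g \<in> carrier G"
    using g by (simp add: generators_def)
  interpret W: pair_wf_digraph "generator_graph G"
    by (rule pair_wf_digraph_generator_graph)
  interpret S: wf_digraph "with_proj ?H"
    by unfold_locales (auto simp: mk_symmetric_def generator_graph_def)
  have 1: "x \<rightarrow>\<^sup>*\<^bsub>with_proj ?H\<^esub> g \<and> g \<rightarrow>\<^sup>*\<^bsub>with_proj ?H\<^esub> x" if x: "x \<in> carrier G" for x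
  proof (cases "x = g")
    case True
    have "g \<in> verts (with_proj ?H)"
      using gc by (simp add: mk_symmetric_def generator_graph_def)
    then show ?thesis
      using True by blast
  next
    case False
    then have "(x, g) \<in> parcs ?H" "(g, x) \<in> parcs ?H"
      using x g gc by (force simp: mk_symmetric_def generator_graph_def)+
    then show ?thesis
      by auto
  qed
  have V: "verts (with_proj ?H) = carrier G"
    by (simp add: mk_symmetric_def generator_graph_def)
  have "x \<rightarrow>\<^sup>*\<^bsub>with_proj ?H\<^esub> y" if "x \<in> carrier G" "y \<in> carrier G" for x y
    using 1[OF that(1)] 1[OF that(2)] S.reachable_trans by blast
  then show ?thesis
    unfolding connected_def strongly_connected_def V
    using gc by blast
qed

end

theory Submission
  imports Defs
begin

text \<open>
  The generators are pairwise twins (each is at distance 1 from every other vertex), and so are the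
  non-generators (at distance 1 from the generators, at distance 2 from each other). A resolving
  set misses at most one vertex of each class of twins. If there is only one non-generator, the
  graph is complete and all vertices are twins. Otherwise omitting one vertex of each class leaves
  a resolving set, because the omitted two are told apart by any other non-generator.
\<close>

text \<open>With unit weights the cost of a walk is its length, so the infimum defining
  \<open>\<mu>\<close> is attained at a shortest walk: \<open>p\<close> itself bounds it from above
  and \<open>min\<close> from below.\<close>

lemma graph_dist_eqI:
  fixes H :: "('a, 'b) pre_digraph"
  assumes "wf_digraph H" and p: "pre_digraph.awalk H u p v"
    and min: "\<And>q. pre_digraph.awalk H u q v \<Longrightarrow> length p \<le> length q"
  shows "graph_dist H u v = real (length p)"
proof -
  have cost: "wf_digraph.awalk_cost (\<lambda>_. 1) q = real (length q)" for q :: "'b list"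
    by (simp add: wf_digraph.awalk_cost_def[OF assms(1)] sum_list_triv)
  show ?thesis
    unfolding graph_dist_def wf_digraph.\<mu>_def[OF assms(1)] cost
    by (rule antisym) (use p min in \<open>auto intro: INF_lower2 INF_greatest\<close>)
qed

lemma graph_dist_self:
  assumes "wf_digraph H" and "v \<in> verts H"
  shows "graph_dist H v v = 0"
  using graph_dist_eqI[OF assms(1), of v "[]" v] assms
  by (simp add: wf_digraph.awalk_Nil_iff zero_ereal_def)

lemma graph_dist_adjacent:
  assumes wf: "wf_digraph H" and "(u, v) \<in> arcs_ends H" and "u \<noteq> v"
  shows "graph_dist H u v = 1"
proof -
  obtain e where e: "e \<in> arcs H" "tail H e = u" "head H e = v"
    using assms(2) by (auto simp: arcs_ends_conv)
  then have "pre_digraph.awalk H u [e] v"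
    using wf_digraph.arc_implies_awalk[OF wf] by auto
  moreover have "1 \<le> length q" if "pre_digraph.awalk H u q v" for q
    using that assms(3) by (cases q) (auto simp: wf_digraph.awalk_Nil_iff[OF wf])
  ultimately show ?thesis
    using graph_dist_eqI[OF wf, of u "[e]" v] by (simp add: one_ereal_def)
qed

text \<open>The walk through \<open>x\<close> has two arcs. A shorter one would be empty, forcing
  \<open>u = v\<close>, or a single arc from \<open>u\<close> to \<open>v\<close>.\<close>

lemma graph_dist_common_neighbour:
  assumes wf: "wf_digraph H" and "(u, x) \<in> arcs_ends H" and "(x, v) \<in> arcs_ends H"
    and "(u, v) \<notin> arcs_ends H" and "u \<noteq> v"
  shows "graph_dist H u v = 2"
proof -
  obtain e f where ef: "e \<in> arcs H" "tail H e = u" "head H e = x"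
      "f \<in> arcs H" "tail H f = x" "head H f = v"
    using assms(2,3) by (auto simp: arcs_ends_conv)
  then have "pre_digraph.awalk H u [e, f] v"
    using wf_digraph.arc_implies_awalk[OF wf, of f]
    by (auto simp: wf_digraph.awalk_Cons_iff[OF wf])
  moreover have "length [e, f] \<le> length q" if q: "pre_digraph.awalk H u q v" for q
  proof (rule ccontr)
    assume "\<not> length [e, f] \<le> length q"
    then consider "q = []" | a where "q = [a]"
      by (cases q) (auto simp: not_le less_Suc_eq)
    then show False
      using q assms(4,5) by cases (auto simp: wf_digraph.awalk_simps[OF wf] arcs_ends_conv)
  qed
  ultimately show ?thesis
    using graph_dist_eqI[OF wf, of u "[e, f]" v] by auto
qed

lemma resolving_set_iff:
  "resolving_set H W \<longleftrightarrow> distinct W \<and> set W \<subseteq> verts H \<and>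
     (\<forall>u\<in>verts H. \<forall>v\<in>verts H. u \<noteq> v \<longrightarrow> (\<exists>w\<in>set W. graph_dist H u w \<noteq> graph_dist H v w))"
  by (simp add: resolving_set_def representation_def)

text \<open>Phrased with distances rather than neighbourhoods, since distances are what a resolving
  set compares. As \<open>w\<close> avoids \<open>u\<close> and \<open>v\<close>, adjacent and
  non-adjacent twins are covered alike.\<close>

definition twins :: "('a, 'b) pre_digraph \<Rightarrow> 'a set \<Rightarrow> bool" where
  "twins H T \<longleftrightarrow> T \<subseteq> verts H \<and>
     (\<forall>u\<in>T. \<forall>v\<in>T. \<forall>w\<in>verts H - {u, v}. graph_dist H u w = graph_dist H v w)"

text \<open>Only \<open>u\<close> or \<open>v\<close> itself can tell twins \<open>u\<close> and
  \<open>v\<close> apart, so two distinct elements of \<open>T\<close> cannot both lie outside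
  \<open>W\<close>. The \<open>+ 1\<close> on the right avoids truncated subtraction.\<close>

lemma resolving_set_twins:
  assumes "resolving_set H W" and "twins H T" and "finite T"
  shows "card T \<le> card (T \<inter> set W) + 1"
proof -
  have T: "T \<subseteq> verts H" and W: "set W \<subseteq> verts H"
    using assms(1,2) by (auto simp: resolving_set_iff twins_def)
  have "u = v" if uv: "u \<in> T - set W" "v \<in> T - set W" for u v
  proof (rule ccontr)
    assume "u \<noteq> v"
    then obtain w where w: "w \<in> set W" "graph_dist H u w \<noteq> graph_dist H v w"
      using assms(1) uv T unfolding resolving_set_iff by blast
    then have "w \<in> verts H - {u, v}"
      using uv W by auto
    then show False
      using w(2) assms(2) uv unfolding twins_def by blast
  qed
  then have "card (T - set W) \<le> 1"
    using assms(3) by (simp add: card_le_Suc0_iff_eq)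
  then show ?thesis
    using card_Diff_subset_Int[of T "set W"] card_mono[of T "T \<inter> set W"] assms(3)
    by auto
qed

text \<open>A vertex of \<open>V\<close> is separated from every other vertex by its own coordinate,
  which is zero for it alone. Hence only pairs outside \<open>V\<close> need checking, and any
  enumeration of \<open>V\<close> serves as the list.\<close>

lemma ex_resolving_setI:
  assumes "wf_digraph H" and "finite (verts H)"
    and nz: "\<And>u v. u \<in> verts H \<Longrightarrow> v \<in> verts H \<Longrightarrow> u \<noteq> v \<Longrightarrow> graph_dist H u v \<noteq> 0"
    and V: "V \<subseteq> verts H"
    and sep: "\<And>u v. u \<in> verts H - V \<Longrightarrow> v \<in> verts H - V \<Longrightarrow> u \<noteq> v \<Longrightarrow>
      \<exists>w\<in>V. graph_dist H u w \<noteq> graph_dist H v w"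
  shows "\<exists>W. resolving_set H W \<and> length W = card V"
proof -
  obtain W where W: "set W = V" "distinct W"
    using finite_distinct_list[of V] finite_subset[OF V assms(2)] by auto
  have "\<exists>w\<in>V. graph_dist H u w \<noteq> graph_dist H v w"
    if "u \<in> verts H" "v \<in> verts H" "u \<noteq> v" for u v
    using that nz[of u v] nz[of v u] sep[of u v] graph_dist_self[OF assms(1)]
    by (metis Diff_iff)
  then have "resolving_set H W"
    using W V by (auto simp: resolving_set_iff)
  then show ?thesis
    using W distinct_card by metis
qed

lemma metric_dimension_eqI:
  assumes "\<exists>W. resolving_set H W \<and> length W = k"
    and "\<And>W. resolving_set H W \<Longrightarrow> k \<le> length W"
  shows "metric_dimension H = k"
  unfolding metric_dimension_def by (rule Least_equality) (use assms in auto)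

lemma wf_digraph_generator_graph: "wf_digraph (with_proj (generator_graph G))"
  by unfold_locales (auto simp: generator_graph_def)

lemma graph_dist_generator_graph:
  assumes "generators G \<noteq> {}" and "u \<in> carrier G" and "v \<in> carrier G"
  shows "graph_dist (with_proj (generator_graph G)) u v =
    (if u = v then 0 else if u \<in> generators G \<or> v \<in> generators G then 1 else 2)"
proof -
  obtain g where g: "g \<in> generators G" "g \<in> carrier G"
    using assms(1) by (auto simp: generators_def)
  note wf = wf_digraph_generator_graph[of G]
  consider "u = v" | "u \<noteq> v" "u \<in> generators G \<or> v \<in> generators G"
    | "u \<noteq> v" "u \<notin> generators G" "v \<notin> generators G"
    by blast
  then show ?thesis
  proof cases
    case 1
    then show ?thesis
      using graph_dist_self[OF wf, of v] assms by (simp add: generator_graph_def)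
  next
    case 2
    then show ?thesis
      using graph_dist_adjacent[OF wf, of u v] assms by (simp add: generator_graph_def)
  next
    case 3
    \<comment> \<open>A generator is adjacent to every other vertex, so \<open>g\<close> is a common
      neighbour of the two non-generators.\<close>
    then have "u \<noteq> g" "v \<noteq> g"
      using g by auto
    with 3 show ?thesis
      using graph_dist_common_neighbour[OF wf, of u g v] assms g by (simp add: generator_graph_def)
  qed
qed

theorem theorem5p2:
  fixes G :: "('a, 'b) monoid_scheme" and n :: nat
  assumes "group G" and "cyclic_group G" and "\<not> trivial_group G"
    and "finite (carrier G)" and "order G = n"
  shows "(n = card (generators G) + 1 \<longrightarrow>
            metric_dimension (with_proj (generator_graph G)) = n - 1) \<and>
         (n \<ge> card (generators G) + 2 \<longrightarrow>
            metric_dimension (with_proj (generator_graph G)) = n - 2)"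
proof -
  let ?H = "with_proj (generator_graph G)"
  define S N where "S = generators G" and "N = carrier G - S"
  have S_ne: "S \<noteq> {}"
    using assms(2) group.cyclic_group_iff_generators[OF assms(1)] by (simp add: S_def)
  have SC: "S \<subseteq> carrier G"
    by (auto simp: S_def generators_def)
  have fin: "finite S" "finite N"
    using assms(4) SC by (auto simp: N_def intro: finite_subset)
  have n: "n = card (carrier G)"
    using assms(5) by (simp add: order_def)
  have nSN: "n = card S + card N"
    using n card_Diff_subset[OF fin(1) SC] card_mono[OF assms(4) SC] by (simp add: N_def)
  have V: "pverts (generator_graph G) = carrier G"
    by (simp add: generator_graph_def)
  have dist: "graph_dist ?H u v = (if u = v then 0 else if u \<in> S \<or> v \<in> S then 1 else 2)"
    if "u \<in> carrier G" "v \<in> carrier G" for u v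
    using graph_dist_generator_graph[of G u v] that S_ne by (simp add: S_def)
  have twS: "twins ?H S" and twN: "twins ?H N"
    by (auto simp: twins_def V dist N_def subsetD[OF SC])
  have len: "length W = card (set W)" "set W \<subseteq> carrier G" if "resolving_set ?H W" for W
    using that V by (auto simp: resolving_set_def distinct_card)
  have resI: "\<exists>W. resolving_set ?H W \<and> length W = card U"
    if "U \<subseteq> carrier G" "\<And>u v. u \<in> carrier G - U \<Longrightarrow> v \<in> carrier G - U \<Longrightarrow> u \<noteq> v \<Longrightarrow>
      \<exists>w\<in>U. graph_dist ?H u w \<noteq> graph_dist ?H v w" for U
    by (rule ex_resolving_setI[OF wf_digraph_generator_graph])
       (use that assms(4) V in \<open>auto simp: dist\<close>)
  obtain s where s: "s \<in> S"
    using S_ne by blast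
  have "metric_dimension ?H = n - 1" if "n = card S + 1"
  proof (rule metric_dimension_eqI)
    have "card N = 1"
      using that nSN by simp
    \<comment> \<open>Two distinct vertices are never both in \<open>N\<close>, so distance 2 does
      not occur and any two vertices are twins.\<close>
    then have "u = v" if "u \<in> N" "v \<in> N" for u v
      using that by (auto simp: card_1_singleton_iff)
    then have twC: "twins ?H (carrier G)"
      by (auto simp: twins_def V dist N_def)
    show "n - 1 \<le> length W" if "resolving_set ?H W" for W
      using resolving_set_twins[OF that twC assms(4)] len[OF that] n
      by (simp add: Int_absorb1)
    \<comment> \<open>With one vertex omitted, no pair of distinct vertices is left to
      separate.\<close>
    have "card (carrier G - {s}) = n - 1"
      using s SC n by (auto simp: card_Diff_singleton)
    then show "\<exists>W. resolving_set ?H W \<and> length W = n - 1"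
      using resI[of "carrier G - {s}"] by auto
  qed
  moreover have "metric_dimension ?H = n - 2" if "n \<ge> card S + 2"
  proof (rule metric_dimension_eqI)
    show "n - 2 \<le> length W" if W: "resolving_set ?H W" for W
    proof -
      \<comment> \<open>\<open>S\<close> and \<open>N\<close> partition the vertices, so the two
        twin bounds add up: each class costs \<open>W\<close> at most one vertex, two in
        total.\<close>
      have "set W = (S \<inter> set W) \<union> (N \<inter> set W)"
        using len(2)[OF W] by (auto simp: N_def)
      then have "card (set W) = card (S \<inter> set W) + card (N \<inter> set W)"
        using card_Un_disjoint[of "S \<inter> set W" "N \<inter> set W"] fin by (auto simp: N_def)
      then show ?thesis
        using resolving_set_twins[OF W twS fin(1)] resolving_set_twins[OF W twN fin(2)]
          len(1)[OF W] nSN by linarith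
    qed
    \<comment> \<open>Of two non-generators, \<open>x\<close> is omitted together with
      \<open>s\<close>, while \<open>y\<close> stays as the witness: it is at distance 1 from
      \<open>s\<close> and 2 from \<open>x\<close>.\<close>
    have "\<not> card N \<le> Suc 0"
      using that nSN by simp
    then obtain x y where xy: "x \<in> N" "y \<in> N" "x \<noteq> y"
      by (auto simp: card_le_Suc0_iff_eq fin(2))
    let ?U = "carrier G - {s, x}"
    have yU: "y \<in> ?U" and neq: "graph_dist ?H s y \<noteq> graph_dist ?H x y"
      using xy s by (auto simp: N_def dist subsetD[OF SC])
    have "card ?U = n - 2"
      using xy s SC n by (subst card_Diff_subset) (auto simp: N_def card_insert_if)
    \<comment> \<open>The only pair outside \<open>?U\<close> is \<open>s\<close> and
      \<open>x\<close>, in either order.\<close>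
    moreover have "\<exists>w\<in>?U. graph_dist ?H u w \<noteq> graph_dist ?H v w"
      if "u \<in> carrier G - ?U" "v \<in> carrier G - ?U" "u \<noteq> v" for u v
      using that yU neq by (intro bexI[of _ y]) auto
    ultimately show "\<exists>W. resolving_set ?H W \<and> length W = n - 2"
      using resI[of ?U] by auto
  qed
  ultimately show ?thesis
    by (simp add: S_def)
qed

end
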